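(* Let $N$ be a finite non-empty set of players, let $\mathbb{R}^n=\prod_{\nu\in N}\mathbb{R}^{n_\nu}$, and let $\theta_\nu:\mathbb{R}^{n_\nu}\times\mathbb{R}^{-n_\nu}\to\mathbb{R}$ ($\nu\in N$) be loss functions. Assume that $\mathfrak{X}\subset\mathbb{R}^n$ is convex, compact and non-empty. If for all $\nu\in N$ the following hold: (1) the function $\theta_\nu$ is pseudocontinuous on its own player's variable and continuous on its rivals' variables (that is, $\theta_\nu(\cdot,x^{-\nu})$ is pseudocontinuous on $\mathbb{R}^{n_\nu}$ for every $x^{-\nu}$, and $\theta_\nu(x^\nu,\cdot)$ is continuous on $\mathbb{R}^{-n_\nu}$ for every $x^\nu$); (2) the function $\theta_\nu$ is quasiconvex on its own player's variable (that is, $\theta_\nu(\cdot,x^{-\nu})$ is quasiconvex for every $x^{-\nu}$); then there exists a generalized Nash equilibrium of the jointly convex generalized Nash equilibrium problem given by $\mathfrak{X}$ and $(\theta_\nu)_{\nu\in N}$.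
   Context: Notation: for $\nu\in N$, $\mathbb{R}^{-n_\nu}=\prod_{\mu\in N\setminus\{\nu\}}\mathbb{R}^{n_\mu}$, and $x\in\mathbb{R}^n$ is written $x=(x^\nu,x^{-\nu})$ with $x^\nu\in\mathbb{R}^{n_\nu}$, $x^{-\nu}\in\mathbb{R}^{-n_\nu}$. Jointly convex generalized Nash equilibrium problem: given $\mathfrak{X}\subset\mathbb{R}^n$, set $\mathfrak{X}_\nu(x^{-\nu})=\{x^\nu\in\mathbb{R}^{n_\nu}: (x^\nu,x^{-\nu})\in\mathfrak{X}\}$. A generalized Nash equilibrium is a vector $\hat x$ such that, for every $\nu\in N$, $\hat x^\nu\in\mathfrak{X}_\nu(\hat x^{-\nu})$ and $\theta_\nu(\hat x^\nu,\hat x^{-\nu})\le\theta_\nu(z^\nu,\hat x^{-\nu})$ for all $z^\nu\in\mathfrak{X}_\nu(\hat x^{-\nu})$. A function $h:X\to\mathbb{R}$ on a Banach space $X$ is lower pseudocontinuous if for all $x,y\in X$ with $h(y)<h(x)$ there is an open neighbourhood $V_x$ of $x$ such that $h(y)<h(x')$ for all $x'\in V_x$; upper pseudocontinuous if for all $x,y\in X$ with $h(y)>h(x)$ there is an open neighbourhood $V_x$ of $x$ such that $h(y)>h(x')$ for all $x'\in V_x$; pseudocontinuous if it is both lower and upper pseudocontinuous. It is quasiconvex if $h(tx+(1-t)y)\le\max\{h(x),h(y)\}$ for all $x,y\in X$, $t\in[0,1]$. *)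

theory Defs
  imports "HOL-Analysis.Analysis"
begin

text \<open>
  The spaces R^(n_nu) have dimensions depending on the player, so the ambient space R^n is taken as
  real^'i together with a map own :: 'i => 'p assigning each coordinate to the player who controls
  it; n_nu is the number of coordinates owned by nu.  R^(n_nu) and R^(-n_nu) are realised as the
  coordinate subspaces of real^'i spanned by the coordinates owned, respectively not owned, by nu.
  The pair (u, w) in R^(n_nu) x R^(-n_nu) is identified with u + w, and accordingly
  theta_nu(u, w) is written theta nu (u + w).
\<close>

definition own_space :: "('i::finite \<Rightarrow> 'p) \<Rightarrow> 'p \<Rightarrow> (real^'i) set" where
  "own_space own \<nu> = {x. \<forall>i. own i \<noteq> \<nu> \<longrightarrow> x $ i = 0}"

definition rival_space :: "('i::finite \<Rightarrow> 'p) \<Rightarrow> 'p \<Rightarrow> (real^'i) set" where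
  "rival_space own \<nu> = {x. \<forall>i. own i = \<nu> \<longrightarrow> x $ i = 0}"

definition own_part :: "('i::finite \<Rightarrow> 'p) \<Rightarrow> 'p \<Rightarrow> real^'i \<Rightarrow> real^'i" where
  "own_part own \<nu> x = (\<chi> i. if own i = \<nu> then x $ i else 0)"

definition rival_part :: "('i::finite \<Rightarrow> 'p) \<Rightarrow> 'p \<Rightarrow> real^'i \<Rightarrow> real^'i" where
  "rival_part own \<nu> x = (\<chi> i. if own i = \<nu> then 0 else x $ i)"

lemma dim_own_space: "dim (own_space own \<nu>) = card {i. own i = \<nu>}"
  using dim_substandard_cart[of "{i. own i = \<nu>}", where 'a = real]
  by (simp add: own_space_def dim_vec_eq)

lemma own_part_plus_rival_part: "own_part own \<nu> x + rival_part own \<nu> x = x"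
  by (simp add: own_part_def rival_part_def vec_eq_iff)

lemma own_part_in_own_space: "own_part own \<nu> x \<in> own_space own \<nu>"
  by (simp add: own_part_def own_space_def)

lemma rival_part_in_rival_space: "rival_part own \<nu> x \<in> rival_space own \<nu>"
  by (simp add: rival_part_def rival_space_def)

lemma own_rival_decomposition_unique:
  assumes "u \<in> own_space own \<nu>" "w \<in> rival_space own \<nu>"
  shows "own_part own \<nu> (u + w) = u" "rival_part own \<nu> (u + w) = w"
  using assms by (auto simp: own_part_def rival_part_def own_space_def rival_space_def vec_eq_iff)

text \<open>Here the set S is the domain of h, with its relative topology.\<close>

definition lower_pseudocontinuous_on :: "'a::topological_space set \<Rightarrow> ('a \<Rightarrow> real) \<Rightarrow> bool" where
  "lower_pseudocontinuous_on S h \<longleftrightarrow>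
    (\<forall>x\<in>S. \<forall>y\<in>S. h y < h x \<longrightarrow>
      (\<exists>V. openin (top_of_set S) V \<and> x \<in> V \<and> (\<forall>x'\<in>V. h y < h x')))"

definition upper_pseudocontinuous_on :: "'a::topological_space set \<Rightarrow> ('a \<Rightarrow> real) \<Rightarrow> bool" where
  "upper_pseudocontinuous_on S h \<longleftrightarrow>
    (\<forall>x\<in>S. \<forall>y\<in>S. h y > h x \<longrightarrow>
      (\<exists>V. openin (top_of_set S) V \<and> x \<in> V \<and> (\<forall>x'\<in>V. h y > h x')))"

definition pseudocontinuous_on :: "'a::topological_space set \<Rightarrow> ('a \<Rightarrow> real) \<Rightarrow> bool" where
  "pseudocontinuous_on S h \<longleftrightarrow> lower_pseudocontinuous_on S h \<and> upper_pseudocontinuous_on S h"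

definition quasiconvex_on :: "'a::real_vector set \<Rightarrow> ('a \<Rightarrow> real) \<Rightarrow> bool" where
  "quasiconvex_on S h \<longleftrightarrow>
    (\<forall>x\<in>S. \<forall>y\<in>S. \<forall>t\<in>{0..1}. h (t *\<^sub>R x + (1 - t) *\<^sub>R y) \<le> max (h x) (h y))"

definition feasible_strategies ::
  "('i::finite \<Rightarrow> 'p) \<Rightarrow> (real^'i) set \<Rightarrow> 'p \<Rightarrow> real^'i \<Rightarrow> (real^'i) set" where
  "feasible_strategies own X \<nu> w = {u \<in> own_space own \<nu>. u + w \<in> X}"

definition generalized_nash_equilibrium ::
  "('i::finite \<Rightarrow> 'p) \<Rightarrow> (real^'i) set \<Rightarrow> ('p \<Rightarrow> real^'i \<Rightarrow> real) \<Rightarrow> real^'i \<Rightarrow> bool" where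
  "generalized_nash_equilibrium own X \<theta> x \<longleftrightarrow>
    (\<forall>\<nu>. own_part own \<nu> x \<in> feasible_strategies own X \<nu> (rival_part own \<nu> x) \<and>
      (\<forall>z\<in>feasible_strategies own X \<nu> (rival_part own \<nu> x).
        \<theta> \<nu> (own_part own \<nu> x + rival_part own \<nu> x) \<le> \<theta> \<nu> (z + rival_part own \<nu> x)))"

end

theory Submission
  imports Defs
begin

text \<open>
  Let S \<nu> x be the set of own strategies that strictly improve player \<nu>'s loss at x.  It is convex
  and relatively open, and an element of S \<nu> x stays in S \<nu> x' for all x' near x, although \<theta> \<nu> is
  not assumed jointly semicontinuous.  Let F x be the set of p whose \<nu>-components lie in the unit
  ball and are normal to S \<nu> x at the own part of x, of norm 1 where S \<nu> x is non-empty.  Then F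
  has non-empty values and a closed graph.  So the sets T x = {y \<in> X. p \<bullet> (y - x) < 0 for all
  p \<in> F x} are convex with relatively open inverse images, and x \<notin> T x.  If x is not an equilibrium,
  a feasible unilateral improvement belongs to T x; if no x were one, T would have a fixed point
  by the theorem of Fan and Browder.
\<close>

section \<open>Fixed points of convex-valued maps with open inverse images\<close>

text \<open>The inverse images of points form an open cover of the compact set \<open>X\<close>. A
  partition of unity subordinate to a finite subcover yields a continuous selection of
  \<open>T\<close>, and Brouwer's theorem gives it a fixed point.\<close>

theorem fan_browder_fixed_point:
  fixes X :: "'a::euclidean_space set" and T :: "'a \<Rightarrow> 'a set"
  assumes X: "compact X" "convex X" "X \<noteq> {}"
    and T: "\<And>x. x \<in> X \<Longrightarrow> T x \<noteq> {}" "\<And>x. x \<in> X \<Longrightarrow> T x \<subseteq> X" "\<And>x. x \<in> X \<Longrightarrow> convex (T x)"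
    and inv: "\<And>y. y \<in> X \<Longrightarrow> openin (top_of_set X) {x \<in> X. y \<in> T x}"
  obtains x where "x \<in> X" "x \<in> T x"
proof -
  have "\<forall>y\<in>X. \<exists>U. open U \<and> {x \<in> X. y \<in> T x} = X \<inter> U"
    using inv unfolding openin_open by blast
  then have "\<exists>U. \<forall>y\<in>X. open (U y) \<and> {x \<in> X. y \<in> T x} = X \<inter> U y"
    by (rule bchoice)
  then obtain U where U: "\<And>y. y \<in> X \<Longrightarrow> open (U y)" "\<And>y. y \<in> X \<Longrightarrow> {x \<in> X. y \<in> T x} = X \<inter> U y"
    by blast
  have in_U: "x \<in> U y \<longleftrightarrow> y \<in> T x" if "x \<in> X" "y \<in> X" for x y
    using U(2)[OF that(2)] that(1) by auto
  have "X \<subseteq> \<Union>(U ` X)"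
  proof
    fix x assume x: "x \<in> X"
    then obtain y where "y \<in> T x" "y \<in> X"
      using T(1)[OF x] T(2)[OF x] by auto
    with x in_U show "x \<in> \<Union>(U ` X)"
      by auto
  qed
  moreover have "open V" if "V \<in> U ` X" for V
    using that U(1) by auto
  ultimately obtain \<C> where \<C>: "\<C> \<subseteq> U ` X" "finite \<C>" "X \<subseteq> \<Union>\<C>"
    by (rule compactE[OF X(1)])
  then have "\<forall>V\<in>\<C>. \<exists>y\<in>X. V = U y"
    by blast
  then have "\<exists>y. \<forall>V\<in>\<C>. y V \<in> X \<and> V = U (y V)"
    by (intro bchoice) (simp only: Bex_def)
  then obtain y where y: "\<And>V. V \<in> \<C> \<Longrightarrow> y V \<in> X" "\<And>V. V \<in> \<C> \<Longrightarrow> V = U (y V)"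
    by blast
  have op: "open V" if "V \<in> \<C>" for V
    using U(1)[OF y(1)[OF that]] y(2)[OF that] by simp
  \<comment> \<open>Local finiteness of the cover is immediate: \<open>\<C>\<close> is finite, so
    the whole space serves as a neighbourhood.\<close>
  have nb: "\<exists>V. open V \<and> x \<in> V \<and> finite {U \<in> \<C>. U \<inter> V \<noteq> {}}" if "x \<in> X" for x
    using \<C>(2) by (intro exI[of _ UNIV]) auto
  obtain F where F: "\<And>V. V \<in> \<C> \<Longrightarrow> continuous_on X (F V) \<and> (\<forall>x\<in>X. 0 \<le> F V x)"
    and F0: "\<And>x V. \<lbrakk>V \<in> \<C>; x \<in> X; x \<notin> V\<rbrakk> \<Longrightarrow> F V x = 0"
    and F1: "\<And>x. x \<in> X \<Longrightarrow> supp_sum (\<lambda>W. F W x) \<C> = (1::real)"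
  proof (rule subordinate_partition_of_unity[OF \<C>(3) op nb])
    fix F :: "'a set \<Rightarrow> 'a \<Rightarrow> real"
    assume "\<And>V. V \<in> \<C> \<Longrightarrow> continuous_on X (F V) \<and> (\<forall>x\<in>X. 0 \<le> F V x)"
      "\<And>x V. \<lbrakk>V \<in> \<C>; x \<in> X; x \<notin> V\<rbrakk> \<Longrightarrow> F V x = 0"
      "\<And>x. x \<in> X \<Longrightarrow> supp_sum (\<lambda>W. F W x) \<C> = 1"
    then show thesis
      by (rule that)
  qed assumption+
  define f where "f x = (\<Sum>V\<in>\<C>. F V x *\<^sub>R y V)" for x
  have f: "f x \<in> T x" if x: "x \<in> X" for x
  proof -
    \<comment> \<open>A set \<open>V\<close> with nonzero weight contains \<open>x\<close>, and
      \<open>V = U (y V)\<close>, so \<open>y V\<close> belongs to \<open>T x\<close>. Hence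
      \<open>f x\<close> is a convex combination of points of \<open>T x\<close>.\<close>
    let ?D = "{V \<in> \<C>. F V x \<noteq> 0}"
    have "f x = (\<Sum>V\<in>?D. F V x *\<^sub>R y V)"
      unfolding f_def using \<C>(2) by (intro sum.mono_neutral_right) auto
    also have "\<dots> \<in> T x"
    proof (rule convex_sum)
      show "sum (\<lambda>V. F V x) ?D = 1"
        using F1[OF x] by (simp add: supp_sum_def support_on_def)
      show "y V \<in> T x" if "V \<in> ?D" for V
        using that F0[OF _ x, of V] in_U[OF x y(1), of V] y(2)[of V] by auto
    qed (use F x \<C>(2) T(3) in auto)
    finally show ?thesis .
  qed
  have "continuous_on X f"
    unfolding f_def using F by (intro continuous_intros) auto
  moreover have "f \<in> X \<rightarrow> X"
    using f T(2) by blast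
  ultimately obtain x where "x \<in> X" "f x = x"
    by (rule brouwer[OF X])
  with f[of x] that show ?thesis
    by simp
qed

section \<open>Projections onto the players' own spaces\<close>

lemma linear_own_part: "linear (own_part own \<nu>)"
  by (rule linearI) (auto simp: own_part_def vec_eq_iff)

lemma linear_rival_part: "linear (rival_part own \<nu>)"
  by (rule linearI) (auto simp: rival_part_def vec_eq_iff)

lemma subspace_own_space: "subspace (own_space own \<nu>)"
  by (auto simp: own_space_def subspace_def)

lemma own_part_ident: "u \<in> own_space own \<nu> \<Longrightarrow> own_part own \<nu> u = u"
  by (auto simp: own_space_def own_part_def vec_eq_iff)

lemma inner_own_part_right:
  "u \<in> own_space own \<nu> \<Longrightarrow> p \<bullet> u = own_part own \<nu> p \<bullet> u"
  unfolding inner_vec_def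
  by (rule sum.cong) (auto simp: own_space_def own_part_def)

lemma sum_own_part: "(\<Sum>\<nu>\<in>UNIV. own_part own \<nu> x) = x"
  for own :: "'i::finite \<Rightarrow> 'p::finite"
  by (simp add: own_part_def vec_eq_iff)

text \<open>In coordinate \<open>i\<close> only the summand of the owner \<open>own i\<close> can be
  nonzero. This glues vectors chosen separately for each player into one vector with prescribed
  components.\<close>

lemma own_part_sum_own_space:
  fixes own :: "'i::finite \<Rightarrow> 'p::finite"
  assumes "\<And>\<mu>. q \<mu> \<in> own_space own \<mu>"
  shows "own_part own \<nu> (\<Sum>\<mu>\<in>UNIV. q \<mu>) = q \<nu>"
proof -
  have "(\<Sum>\<mu>\<in>UNIV. q \<mu> $ i) = q (own i) $ i" for i
  proof -
    have "(\<Sum>\<mu>\<in>UNIV. q \<mu> $ i) = (\<Sum>\<mu>\<in>UNIV. if \<mu> = own i then q \<mu> $ i else 0)"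
      using assms by (intro sum.cong) (auto simp: own_space_def)
    then show ?thesis
      by simp
  qed
  then show ?thesis
    using assms[of \<nu>] by (auto simp: own_part_def own_space_def vec_eq_iff)
qed

section \<open>Small polytopes around a point of a subspace\<close>

text \<open>\<open>B\<close> is the image under \<open>P\<close> of the vertices of a small cube
  around \<open>z\<close>; a fixed point of \<open>P\<close> inside the cube lies in the image of
  the cube, which is the hull of \<open>B\<close>.\<close>

lemma subspace_polytope_neighbourhood:
  fixes P :: "'a::euclidean_space \<Rightarrow> 'a"
  assumes P: "linear P" "P z = z" and e: "e > 0"
  obtains B r where "finite B" "B \<subseteq> P ` UNIV" "B \<subseteq> ball z e" "r > 0"
    "\<And>u. P u = u \<Longrightarrow> dist u z < r \<Longrightarrow> u \<in> convex hull B"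
proof -
  have "continuous_on UNIV P"
    by (simp add: P(1) linear_continuous_on linear_linear)
  then obtain d where d: "d > 0" "\<And>u. dist u z < d \<Longrightarrow> dist (P u) z < e"
    using e P(2) unfolding continuous_on_iff by (metis UNIV_I)
  \<comment> \<open>Half the side of the cube, chosen so that the 1-norm bound
    \<open>DIM('a) * c\<close> on the distance from \<open>z\<close> stays below
    \<open>d\<close>.\<close>
  define c where "c = d / (2 * (DIM('a) + 1))"
  have c: "c > 0"
    using d by (simp add: c_def)
  let ?c = "(\<Sum>i\<in>Basis. c *\<^sub>R i) :: 'a"
  obtain S :: "'a set" where S: "finite S" "cbox (z - ?c) (z + ?c) = convex hull S"
    using cube_convex_hull[OF c] by blast
  have near: "dist u z < d" if "u \<in> cbox (z - ?c) (z + ?c)" for u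
  proof -
    have b: "\<bar>(u - z) \<bullet> i\<bar> \<le> c" if "i \<in> Basis" for i
    proof -
      have "?c \<bullet> i = c" using that by simp
      moreover have "(z - ?c) \<bullet> i \<le> u \<bullet> i \<and> u \<bullet> i \<le> (z + ?c) \<bullet> i"
        using \<open>u \<in> cbox _ _\<close> that unfolding mem_box by blast
      ultimately show ?thesis by (simp only: inner_diff_left inner_add_left) linarith
    qed
    have "dist u z \<le> (\<Sum>i\<in>Basis. \<bar>(u - z) \<bullet> i\<bar>)"
      unfolding dist_norm by (rule norm_le_l1)
    also have "\<dots> \<le> DIM('a) * c"
      using sum_mono[of Basis "\<lambda>i. \<bar>(u - z) \<bullet> i\<bar>" "\<lambda>_. c"] b by simp
    also have "\<dots> < d"
      using d(1) by (auto simp: c_def field_simps intro!: add_nonneg_pos)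
    finally show ?thesis .
  qed
  show ?thesis
  proof
    show "finite (P ` S)" "P ` S \<subseteq> P ` UNIV"
      using S by auto
    show "P ` S \<subseteq> ball z e"
      using near d(2) S(2) hull_subset[of S convex] by (auto simp: dist_commute)
    \<comment> \<open>The radius \<open>r\<close> is \<open>c\<close>: a ball of this radius fits
      into the cube.\<close>
    show "c > 0" by fact
    show "u \<in> convex hull (P ` S)" if u: "P u = u" "dist u z < c" for u
    proof -
      have "u \<in> cbox (z - ?c) (z + ?c)"
        unfolding mem_box
      proof
        fix i :: 'a assume i: "i \<in> Basis"
        have "\<bar>(u - z) \<bullet> i\<bar> < c"
          using Basis_le_norm[OF i, of "u - z"] u(2) by (simp add: dist_norm)
        moreover have "?c \<bullet> i = c" using i by simp
        ultimately show "(z - ?c) \<bullet> i \<le> u \<bullet> i \<and> u \<bullet> i \<le> (z + ?c) \<bullet> i"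
          by (simp only: inner_diff_left inner_add_left) linarith
      qed
      then have "P u \<in> P ` (convex hull S)"
        using S(2) by blast
      then show ?thesis
        using convex_hull_linear_image[OF P(1)] u(1) by metis
    qed
  qed
qed

section \<open>Sublevel sets of quasiconvex functions; pseudocontinuity in metric form\<close>

lemma quasiconvex_on_convex_sublevel:
  assumes "convex S" "quasiconvex_on S h"
  shows "convex {u \<in> S. h u \<le> M}"
  unfolding convex_alt
proof clarsimp
  fix x y t assume x: "x \<in> S" "y \<in> S" "h x \<le> M" "h y \<le> M" and t: "0 \<le> t" "t \<le> (1::real)"
  \<comment> \<open>The weight \<open>t\<close> belongs to the first point in
    \<open>quasiconvex_on\<close> and to the second in \<open>convex_alt\<close>, hence the exchange
    of \<open>x\<close> and \<open>y\<close>.\<close>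
  have "h (t *\<^sub>R y + (1 - t) *\<^sub>R x) \<le> max (h y) (h x)"
    using assms(2) x t unfolding quasiconvex_on_def by auto
  moreover have "(1 - t) *\<^sub>R x + t *\<^sub>R y \<in> S"
    using assms(1) x t by (auto simp: convex_alt)
  ultimately show "(1 - t) *\<^sub>R x + t *\<^sub>R y \<in> S \<and> h ((1 - t) *\<^sub>R x + t *\<^sub>R y) \<le> M"
    using x by (auto simp: add.commute)
qed

lemma quasiconvex_on_convex_strict_sublevel:
  assumes "convex S" "quasiconvex_on S h"
  shows "convex {u \<in> S. h u < M}"
  unfolding convex_alt
proof clarsimp
  fix x y t assume x: "x \<in> S" "y \<in> S" "h x < M" "h y < M" and t: "0 \<le> t" "t \<le> (1::real)"
  have "h (t *\<^sub>R y + (1 - t) *\<^sub>R x) \<le> max (h y) (h x)"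
    using assms(2) x t unfolding quasiconvex_on_def by auto
  moreover have "(1 - t) *\<^sub>R x + t *\<^sub>R y \<in> S"
    using assms(1) x t by (auto simp: convex_alt)
  ultimately show "(1 - t) *\<^sub>R x + t *\<^sub>R y \<in> S \<and> h ((1 - t) *\<^sub>R x + t *\<^sub>R y) < M"
    using x by (auto simp: add.commute)
qed

lemma lower_pseudocontinuous_onD:
  fixes S :: "'a::metric_space set"
  assumes "lower_pseudocontinuous_on S h" "x \<in> S" "y \<in> S" "h y < h x"
  obtains e where "e > 0" "\<And>u. u \<in> S \<Longrightarrow> dist u x < e \<Longrightarrow> h y < h u"
proof -
  have "\<exists>V. openin (top_of_set S) V \<and> x \<in> V \<and> (\<forall>u\<in>V. h y < h u)"
    using assms by (simp add: lower_pseudocontinuous_on_def)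
  then obtain V where V: "openin (top_of_set S) V" "x \<in> V" "\<And>u. u \<in> V \<Longrightarrow> h y < h u"
    by auto
  obtain e where "e > 0" "\<And>u. u \<in> S \<Longrightarrow> dist u x < e \<Longrightarrow> u \<in> V"
    using V(1,2) unfolding openin_euclidean_subtopology_iff by metis
  with V(3) show ?thesis
    by (intro that) auto
qed

lemma upper_pseudocontinuous_onD:
  fixes S :: "'a::metric_space set"
  assumes "upper_pseudocontinuous_on S h" "x \<in> S" "y \<in> S" "h x < h y"
  obtains e where "e > 0" "\<And>u. u \<in> S \<Longrightarrow> dist u x < e \<Longrightarrow> h u < h y"
proof -
  have "\<exists>V. openin (top_of_set S) V \<and> x \<in> V \<and> (\<forall>u\<in>V. h u < h y)"
    using assms by (simp add: upper_pseudocontinuous_on_def)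
  then obtain V where V: "openin (top_of_set S) V" "x \<in> V" "\<And>u. u \<in> V \<Longrightarrow> h u < h y"
    by auto
  obtain e where "e > 0" "\<And>u. u \<in> S \<Longrightarrow> dist u x < e \<Longrightarrow> u \<in> V"
    using V(1,2) unfolding openin_euclidean_subtopology_iff by metis
  with V(3) show ?thesis
    by (intro that) auto
qed

section \<open>Persistence of strict improvements under perturbation\<close>

text \<open>
  Surround z by a polytope with vertices B in the open set of improving strategies.  A point w
  slightly off the own part of a towards z is worse than every vertex at a, hence, B being finite,
  also when the rivals play as in x k; but w lies in the convex hull of B and the own part of x k,
  so by quasiconvexity that own part is worse than every vertex, and hence worse than z.
\<close>

lemma strict_sublevel_persistent:
  fixes own :: "'i::finite \<Rightarrow> 'p" and \<nu> :: 'p and \<theta> :: "real^'i \<Rightarrow> real" and x :: "'b \<Rightarrow> real^'i"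
  defines "P \<equiv> own_part own \<nu>" and "Q \<equiv> rival_part own \<nu>"
  assumes psc: "\<And>w. w \<in> rival_space own \<nu> \<Longrightarrow>
           pseudocontinuous_on (own_space own \<nu>) (\<lambda>u. \<theta> (u + w))"
    and cont: "\<And>u. u \<in> own_space own \<nu> \<Longrightarrow>
           continuous_on (rival_space own \<nu>) (\<lambda>w. \<theta> (u + w))"
    and qcx: "\<And>w. w \<in> rival_space own \<nu> \<Longrightarrow>
           quasiconvex_on (own_space own \<nu>) (\<lambda>u. \<theta> (u + w))"
    and lim: "(x \<longlongrightarrow> a) G"
    and z: "z \<in> own_space own \<nu>" "\<theta> (z + Q a) < \<theta> a"
  shows "\<forall>\<^sub>F k in G. \<theta> (z + Q (x k)) < \<theta> (x k)"
proof -
  let ?E = "own_space own \<nu>" and ?W = "rival_space own \<nu>"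
  have PQ: "P v + Q v = v" and PE: "P v \<in> ?E" and QW: "Q v \<in> ?W" for v
    unfolding P_def Q_def
    by (simp_all add: own_part_plus_rival_part own_part_in_own_space rival_part_in_rival_space)
  have lin: "linear P" "linear Q"
    unfolding P_def Q_def by (simp_all add: linear_own_part linear_rival_part)
  have limP: "((\<lambda>k. P (x k)) \<longlongrightarrow> P a) G" and limQ: "((\<lambda>k. Q (x k)) \<longlongrightarrow> Q a) G"
    using lin lim by (simp_all add: linear_linear bounded_linear.tendsto)
  have ident: "P u = u" if "u \<in> ?E" for u
    unfolding P_def using that by (rule own_part_ident)
  \<comment> \<open>\<open>h v u\<close> is the loss of own strategy \<open>u\<close> against the
    rivals' strategies in \<open>v\<close>.\<close>
  define h where "h v u = \<theta> (u + Q v)" for v u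
  have hP: "h v (P v) = \<theta> v" for v
    by (simp add: h_def PQ)
  have lower: "lower_pseudocontinuous_on ?E (h v)" and upper: "upper_pseudocontinuous_on ?E (h v)" for v
    using psc[OF QW, of v] by (simp_all add: pseudocontinuous_on_def h_def[abs_def])
  have qcx_h: "quasiconvex_on ?E (h v)" for v
    using qcx[OF QW, of v] by (simp add: h_def[abs_def])
  have convE: "convex ?E"
    by (simp add: subspace_own_space subspace_imp_convex)
  \<comment> \<open>The convergence is only pointwise in \<open>u\<close>; below it is applied to
    \<open>w\<close> and the finitely many vertices in \<open>B\<close>.\<close>
  have lim_h: "((\<lambda>k. h (x k) u) \<longlongrightarrow> h a u) G" if "u \<in> ?E" for u
    unfolding h_def using continuous_on_tendsto_compose[OF cont[OF that] limQ] QW by auto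
  have "h a z < h a (P a)"
    using z(2) hP by (simp add: h_def)
  then obtain e where e: "e > 0" "\<And>u. u \<in> ?E \<Longrightarrow> dist u z < e \<Longrightarrow> h a u < h a (P a)"
    using upper_pseudocontinuous_onD[OF upper z(1) PE] by metis
  obtain B r where B: "finite B" "B \<subseteq> P ` UNIV" "B \<subseteq> ball z e" "r > 0"
    and hull: "\<And>u. P u = u \<Longrightarrow> dist u z < r \<Longrightarrow> u \<in> convex hull B"
    using subspace_polytope_neighbourhood[OF lin(1) ident[OF z(1)] e(1)] by metis
  have BE: "B \<subseteq> ?E"
    using B(2) PE by blast
  have zB: "z \<in> convex hull B"
    using hull ident z(1) \<open>r > 0\<close> by simp
  then have "B \<noteq> {}"
    by auto
  \<comment> \<open>Pseudocontinuity compares only with values that the function attains; the worst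
    vertex \<open>b0\<close> supplies such a value, below which no strategy near \<open>P a\<close>
    falls.\<close>
  then obtain b0 where b0: "b0 \<in> B" "\<And>b. b \<in> B \<Longrightarrow> h a b \<le> h a b0"
    using obtains_MAX[OF B(1), of "h a"] B(1) by (metis Max_ge finite_imageI imageI)
  have "h a b0 < h a (P a)"
    using b0(1) BE B(3) by (intro e(2)) (auto simp: dist_commute)
  then obtain e' where e': "e' > 0" "\<And>u. u \<in> ?E \<Longrightarrow> dist u (P a) < e' \<Longrightarrow> h a b0 < h a u"
    using lower_pseudocontinuous_onD[OF lower PE, of b0] b0(1) BE by (metis subsetD)
  \<comment> \<open>The second bound keeps \<open>w\<close> within \<open>e'\<close> of
    \<open>P a\<close>, the \<open>+ 1\<close> keeping its denominator positive; the first gives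
    \<open>\<epsilon> < 1\<close>.\<close>
  define \<epsilon> where "\<epsilon> = min (1/2) (e' / (2 * (norm (z - P a) + 1)))"
  have \<epsilon>: "0 < \<epsilon>" "\<epsilon> < 1"
    using e'(1) by (auto simp: \<epsilon>_def intro!: divide_pos_pos add_nonneg_pos)
  define w where "w = P a + \<epsilon> *\<^sub>R (z - P a)"
  have wE: "w \<in> ?E"
    unfolding w_def using subspace_own_space PE z(1)
    by (intro subspace_add subspace_scale subspace_diff) auto
  have "dist w (P a) = \<epsilon> * norm (z - P a)"
    using \<epsilon> by (simp add: w_def dist_norm)
  also have "\<dots> \<le> e' / (2 * (norm (z - P a) + 1)) * norm (z - P a)"
    by (intro mult_right_mono) (auto simp: \<epsilon>_def)
  also have "\<dots> = (e' / 2) * (norm (z - P a) / (norm (z - P a) + 1))"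
    by simp
  also have "\<dots> \<le> (e' / 2) * 1"
    using e'(1) by (intro mult_left_mono) (simp_all add: divide_le_eq_1_pos add_nonneg_pos)
  also have "\<dots> < e'" using e'(1) by simp
  finally have wb: "h a b < h a w" if "b \<in> B" for b
    using e'(2)[OF wE] b0(2)[OF that] by linarith
  have ev1: "\<forall>\<^sub>F k in G. \<forall>b\<in>B. h (x k) b < h (x k) w"
  proof (rule eventually_ball_finite[OF B(1)], rule ballI)
    fix b assume b: "b \<in> B"
    show "\<forall>\<^sub>F k in G. h (x k) b < h (x k) w"
      using order_tendstoD(1)[OF tendsto_diff[OF lim_h[OF wE] lim_h[of b]], of 0] wb[OF b] b BE
      by (auto elim: eventually_mono)
  qed
  \<comment> \<open>\<open>u k\<close> solves \<open>w = (1 - \<epsilon>) *\<^sub>R P (x k) +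
    \<epsilon> *\<^sub>R u k\<close> with \<open>w\<close> fixed. It tends to \<open>z\<close>, so
    it eventually enters the polytope.\<close>
  define \<delta> where "\<delta> = (1 - \<epsilon>) / \<epsilon>"
  define u where "u k = z + \<delta> *\<^sub>R (P a - P (x k))" for k
  have "(u \<longlongrightarrow> z + \<delta> *\<^sub>R (P a - P a)) G"
    unfolding u_def by (intro tendsto_intros limP)
  then have ev2: "\<forall>\<^sub>F k in G. dist (u k) z < r"
    using \<open>r > 0\<close> by (simp add: tendsto_iff)
  show ?thesis
    using ev1 ev2
  proof eventually_elim
    case (elim k)
    define M where "M = Max (h (x k) ` B)"
    let ?C = "{v \<in> ?E. h (x k) v \<le> M}"
    have convC: "convex ?C"
      by (rule quasiconvex_on_convex_sublevel[OF convE qcx_h])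
    have "B \<subseteq> ?C"
      using BE B(1) by (auto simp: M_def)
    then have BC: "convex hull B \<subseteq> ?C"
      using convC by (rule hull_minimal)
    have "M < h (x k) w"
      using elim(1) B(1) \<open>B \<noteq> {}\<close> by (simp add: M_def)
    have uE: "u k \<in> ?E"
      unfolding u_def using subspace_own_space PE z(1)
      by (intro subspace_add subspace_scale subspace_diff) auto
    have "u k \<in> ?C"
      using hull[OF ident[OF uE] elim(2)] BC by blast
    have "\<epsilon> * \<delta> = 1 - \<epsilon>"
      using \<epsilon> by (simp add: \<delta>_def)
    then have "\<epsilon> *\<^sub>R u k = \<epsilon> *\<^sub>R z + (1 - \<epsilon>) *\<^sub>R (P a - P (x k))"
      by (simp add: u_def scaleR_add_right)
    then have w: "w = (1 - \<epsilon>) *\<^sub>R P (x k) + \<epsilon> *\<^sub>R u k"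
      by (simp add: w_def algebra_simps)
    have "P (x k) \<notin> ?C"
    proof
      assume "P (x k) \<in> ?C"
      then have "w \<in> ?C"
        unfolding w using convexD_alt[OF convC _ \<open>u k \<in> ?C\<close>] \<epsilon> by simp
      with \<open>M < h (x k) w\<close> show False by simp
    qed
    then have "M < \<theta> (x k)"
      using PE[of "x k"] hP[of "x k"] by simp
    moreover have "h (x k) z \<le> M"
      using zB BC by blast
    ultimately show ?case
      by (simp add: h_def)
  qed
qed

section \<open>Existence of an equilibrium\<close>

theorem theorem3p5:
  fixes own :: "'i::finite \<Rightarrow> 'p::finite"
    and X :: "(real^'i) set"
    and \<theta> :: "'p \<Rightarrow> real^'i \<Rightarrow> real"
  assumes "convex X" and "compact X" and "X \<noteq> {}"
    and "\<And>\<nu> w. w \<in> rival_space own \<nu> \<Longrightarrow>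
           pseudocontinuous_on (own_space own \<nu>) (\<lambda>u. \<theta> \<nu> (u + w))"
    and "\<And>\<nu> u. u \<in> own_space own \<nu> \<Longrightarrow>
           continuous_on (rival_space own \<nu>) (\<lambda>w. \<theta> \<nu> (u + w))"
    and "\<And>\<nu> w. w \<in> rival_space own \<nu> \<Longrightarrow>
           quasiconvex_on (own_space own \<nu>) (\<lambda>u. \<theta> \<nu> (u + w))"
  shows "\<exists>x. generalized_nash_equilibrium own X \<theta> x"
proof (rule ccontr)
  assume noeq: "\<nexists>x. generalized_nash_equilibrium own X \<theta> x"
  let ?E = "own_space own" and ?P = "own_part own" and ?Q = "rival_part own"
  \<comment> \<open>Feasibility is left out here, so that \<open>S \<nu> x\<close> is open in the
    whole own space; it enters through \<open>T\<close>, whose values lie in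
    \<open>X\<close>.\<close>
  define S where "S \<nu> x = {z \<in> ?E \<nu>. \<theta> \<nu> (z + ?Q \<nu> x) < \<theta> \<nu> x}" for \<nu> x
  have S_lim: "\<forall>\<^sub>F k in G. z \<in> S \<nu> (x k)" if "(x \<longlongrightarrow> a) G" "z \<in> S \<nu> a"
    for \<nu> z a G and x :: "nat \<Rightarrow> real^'i"
    using strict_sublevel_persistent[where \<theta> = "\<theta> \<nu>", OF assms(4,5,6) that(1)] that(2)
    by (simp add: S_def)
  have S_own: "?P \<nu> x \<notin> S \<nu> x" for \<nu> x
    by (simp add: S_def own_part_plus_rival_part)
  have S_conv: "convex (S \<nu> x)" for \<nu> x
    unfolding S_def
    by (intro quasiconvex_on_convex_strict_sublevel subspace_imp_convex subspace_own_space
        assms(6) rival_part_in_rival_space)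
  have S_open: "\<exists>e>0. \<forall>u\<in>?E \<nu>. dist u z < e \<longrightarrow> u \<in> S \<nu> x" if "z \<in> S \<nu> x" for z \<nu> x
  proof -
    \<comment> \<open>The threshold \<open>\<theta> \<nu> x\<close> is the value at the own part of
      \<open>x\<close>, hence attained, as upper pseudocontinuity requires.\<close>
    have z: "z \<in> ?E \<nu>" "\<theta> \<nu> (z + ?Q \<nu> x) < \<theta> \<nu> (?P \<nu> x + ?Q \<nu> x)"
      using that by (simp_all add: S_def own_part_plus_rival_part)
    have "upper_pseudocontinuous_on (?E \<nu>) (\<lambda>u. \<theta> \<nu> (u + ?Q \<nu> x))"
      using assms(4)[OF rival_part_in_rival_space] by (simp add: pseudocontinuous_on_def)
    from upper_pseudocontinuous_onD[OF this z(1) own_part_in_own_space z(2)] obtain e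
      where "e > 0"
        "\<And>u. u \<in> ?E \<nu> \<Longrightarrow> dist u z < e \<Longrightarrow> \<theta> \<nu> (u + ?Q \<nu> x) < \<theta> \<nu> (?P \<nu> x + ?Q \<nu> x)"
      by auto
    then show ?thesis
      by (auto simp: S_def own_part_plus_rival_part)
  qed
  \<comment> \<open>Norm 1 excludes the zero vector where an improvement exists. Elsewhere the whole
    unit ball is allowed, so that limits stay in \<open>K\<close> when \<open>S\<close> becomes
    empty.\<close>
  define K where "K \<nu> x = {q \<in> ?E \<nu>. norm q \<le> 1 \<and> (S \<nu> x \<noteq> {} \<longrightarrow> norm q = 1)
    \<and> (\<forall>z\<in>S \<nu> x. q \<bullet> (z - ?P \<nu> x) \<le> 0)}" for \<nu> x
  define F where "F x = {p. \<forall>\<nu>. ?P \<nu> p \<in> K \<nu> x}" for x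
  have K_ne: "\<exists>q. q \<in> K \<nu> x" for \<nu> x
  proof (cases "S \<nu> x = {}")
    case True
    then have "0 \<in> K \<nu> x"
      by (simp add: K_def subspace_own_space subspace_0)
    then show ?thesis ..
  next
    case False
    let ?D = "(\<lambda>z. z - ?P \<nu> x) ` S \<nu> x"
    have "convex ?D"
      using S_conv by simp
    \<comment> \<open>Separation inside the span of \<open>?D\<close> keeps the normal vector in the
      own space of \<open>\<nu>\<close>; it is then normalised, with its sign reversed.\<close>
    moreover have "0 \<notin> ?D"
      using S_own by auto
    ultimately obtain a where a: "a \<in> span ?D" "a \<noteq> 0" "\<And>v. v \<in> ?D \<Longrightarrow> 0 \<le> a \<bullet> v"
      using False separating_hyperplane_set_0_inspan[of ?D] by auto
    have "?D \<subseteq> ?E \<nu>"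
      using subspace_own_space own_part_in_own_space by (auto simp: S_def intro!: subspace_diff)
    then have "span ?D \<subseteq> ?E \<nu>"
      by (rule span_minimal[OF _ subspace_own_space])
    with a(1) have "- (a /\<^sub>R norm a) \<in> ?E \<nu>"
      using subspace_own_space by (auto intro!: subspace_neg subspace_scale)
    moreover have "0 \<le> a \<bullet> (z - ?P \<nu> x)" if "z \<in> S \<nu> x" for z
      using that by (intro a(3)) simp
    ultimately have "- (a /\<^sub>R norm a) \<in> K \<nu> x"
      using a(2) by (simp add: K_def)
    then show ?thesis ..
  qed
  have F_ne: "F x \<noteq> {}" for x
  proof -
    have "\<forall>\<nu>. \<exists>q. q \<in> K \<nu> x"
      using K_ne by blast
    then have "\<exists>q. \<forall>\<nu>. q \<nu> \<in> K \<nu> x"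
      by (rule choice)
    then obtain q where q: "\<And>\<nu>. q \<nu> \<in> K \<nu> x"
      by blast
    then have "q \<nu> \<in> ?E \<nu>" for \<nu>
      by (simp add: K_def)
    then have "(\<Sum>\<nu>\<in>UNIV. q \<nu>) \<in> F x"
      using q by (simp add: F_def own_part_sum_own_space)
    then show ?thesis by blast
  qed
  have K_neg: "q \<bullet> (z - ?P \<nu> x) < 0" if q: "q \<in> K \<nu> x" and z: "z \<in> S \<nu> x" for q z \<nu> x
  proof -
    have qE: "q \<in> ?E \<nu>" and nq: "norm q = 1"
      using q z by (auto simp: K_def)
    obtain e where e: "e > 0" "\<And>u. u \<in> ?E \<nu> \<Longrightarrow> dist u z < e \<Longrightarrow> u \<in> S \<nu> x"
      using S_open[OF z] by auto
    \<comment> \<open>Moving \<open>z\<close> along \<open>q\<close> stays in the open set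
      \<open>S \<nu> x\<close> and raises the inner product by \<open>e/2\<close>, so the inequality
      at \<open>z\<close> is strict.\<close>
    have "z + (e/2) *\<^sub>R q \<in> ?E \<nu>"
      using z qE subspace_own_space by (auto simp: S_def intro!: subspace_add subspace_scale)
    moreover have "dist (z + (e/2) *\<^sub>R q) z < e"
      using e(1) nq by (simp add: dist_norm)
    ultimately have "z + (e/2) *\<^sub>R q \<in> S \<nu> x"
      by (rule e(2))
    then have "q \<bullet> (z + (e/2) *\<^sub>R q - ?P \<nu> x) \<le> 0"
      using q by (simp add: K_def)
    moreover have "q \<bullet> q = 1"
      using nq by (simp add: dot_square_norm)
    ultimately show ?thesis
      using e(1) by (simp add: inner_diff_right inner_add_right)
  qed
  have F_bound: "norm p \<le> CARD('p)" if "p \<in> F x" for p x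
  proof -
    have "norm p = norm (\<Sum>\<nu>\<in>UNIV. ?P \<nu> p)"
      by (simp add: sum_own_part)
    also have "\<dots> \<le> (\<Sum>\<nu>\<in>(UNIV::'p set). 1)"
      using that by (intro sum_norm_le) (simp add: F_def K_def)
    finally show ?thesis by simp
  qed
  \<comment> \<open>Each \<open>z\<close> in \<open>S \<nu> a\<close> eventually lies in
    \<open>S \<nu> (x k)\<close>, so both the norm condition and the inequality at \<open>z\<close>
    pass to the limit.\<close>
  have F_lim: "p \<in> F a" if x: "x \<longlonglongrightarrow> a" and p: "pk \<longlonglongrightarrow> p" and pF: "\<And>k. pk k \<in> F (x k)"
    for a p and x pk :: "nat \<Rightarrow> real^'i"
  proof -
    have "?P \<nu> p \<in> K \<nu> a" for \<nu>
    proof -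
      have "bounded_linear (?P \<nu>)"
        using linear_own_part by (simp add: linear_linear)
      from bounded_linear.tendsto[OF this p] bounded_linear.tendsto[OF this x]
      have lim: "(\<lambda>k. ?P \<nu> (pk k)) \<longlonglongrightarrow> ?P \<nu> p" "(\<lambda>k. ?P \<nu> (x k)) \<longlonglongrightarrow> ?P \<nu> a" .
      have pK: "?P \<nu> (pk k) \<in> K \<nu> (x k)" for k
        using pF by (simp add: F_def)
      have "norm (?P \<nu> p) \<le> 1"
        using pK by (intro LIMSEQ_le_const2[OF tendsto_norm[OF lim(1)]]) (auto simp: K_def)
      moreover have "norm (?P \<nu> p) = 1" if z: "z \<in> S \<nu> a" for z
      proof -
        have "\<forall>\<^sub>F k in sequentially. norm (?P \<nu> (pk k)) = 1"
          using S_lim[OF x z] by (rule eventually_mono) (use pK in \<open>auto simp: K_def\<close>)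
        then have "(\<lambda>k. norm (?P \<nu> (pk k))) \<longlonglongrightarrow> 1"
          by (rule tendsto_eventually)
        with tendsto_norm[OF lim(1)] show ?thesis
          by (rule LIMSEQ_unique)
      qed
      moreover have "?P \<nu> p \<bullet> (z - ?P \<nu> a) \<le> 0" if z: "z \<in> S \<nu> a" for z
      proof (rule tendsto_upperbound)
        show "(\<lambda>k. ?P \<nu> (pk k) \<bullet> (z - ?P \<nu> (x k))) \<longlonglongrightarrow> ?P \<nu> p \<bullet> (z - ?P \<nu> a)"
          by (intro tendsto_intros lim)
        show "\<forall>\<^sub>F k in sequentially. ?P \<nu> (pk k) \<bullet> (z - ?P \<nu> (x k)) \<le> 0"
          using S_lim[OF x z] by (rule eventually_mono) (use pK in \<open>auto simp: K_def\<close>)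
      qed simp
      ultimately show ?thesis
        by (auto simp: K_def own_part_in_own_space)
    qed
    then show ?thesis by (simp add: F_def)
  qed
  define T where "T x = {y \<in> X. \<forall>p\<in>F x. p \<bullet> (y - x) < 0}" for x
  have T_ne: "T x \<noteq> {}" if x: "x \<in> X" for x
  proof -
    \<comment> \<open>For \<open>x\<close> in \<open>X\<close> the own parts are feasible, so only
      minimality can fail.\<close>
    have "\<exists>\<nu> z. z \<in> ?E \<nu> \<and> z + ?Q \<nu> x \<in> X \<and> \<theta> \<nu> (z + ?Q \<nu> x) < \<theta> \<nu> x"
      using noeq x
      by (auto simp: generalized_nash_equilibrium_def feasible_strategies_def not_le
          own_part_plus_rival_part own_part_in_own_space)
    then obtain \<nu> z where z: "z \<in> S \<nu> x" "z + ?Q \<nu> x \<in> X"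
      by (auto simp: S_def)
    have eq: "z + ?Q \<nu> x - x = z - ?P \<nu> x"
      using own_part_plus_rival_part[of own \<nu> x] by (simp add: algebra_simps)
    \<comment> \<open>The deviation changes only the component of \<open>\<nu>\<close>, so
      \<open>p\<close> acts on it through \<open>?P \<nu> p\<close>, an element of
      \<open>K \<nu> x\<close>.\<close>
    have "z - ?P \<nu> x \<in> ?E \<nu>"
      using z subspace_own_space own_part_in_own_space by (auto simp: S_def intro!: subspace_diff)
    then have "p \<bullet> (z + ?Q \<nu> x - x) < 0" if "p \<in> F x" for p
      using K_neg[OF _ z(1)] that unfolding eq by (simp add: inner_own_part_right[of _ own \<nu> p] F_def)
    then show ?thesis
      using z(2) by (auto simp: T_def)
  qed
  have T_conv: "convex (T x)" for x
  proof -
    have "T x = X \<inter> (\<Inter>p\<in>F x. {y. p \<bullet> y < p \<bullet> x})"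
      by (auto simp: T_def inner_diff_right)
    then show ?thesis
      using assms(1) by (auto intro!: convex_Int convex_INT convex_halfspace_lt)
  qed
  have T_open: "openin (top_of_set X) {x \<in> X. y \<in> T x}" if y: "y \<in> X" for y
  proof -
    \<comment> \<open>A pair in \<open>?G\<close> certifies that \<open>y\<close> is not in
      \<open>T x\<close>. The closed graph and the uniform bound on \<open>F\<close> make
      \<open>?G\<close> compact, so its projection, the complement of the inverse image, is
      closed.\<close>
    let ?G = "{(x, p). x \<in> X \<and> p \<in> F x \<and> 0 \<le> p \<bullet> (y - x)}"
    have "closed ?G"
      unfolding closed_sequential_limits
    proof clarify
      fix s a p assume s: "\<forall>n. s n \<in> ?G" and l: "s \<longlonglongrightarrow> (a, p)"
      have lx: "(\<lambda>n. fst (s n)) \<longlonglongrightarrow> a" and lp: "(\<lambda>n. snd (s n)) \<longlonglongrightarrow> p"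
        using tendsto_fst[OF l] tendsto_snd[OF l] by auto
      have s': "fst (s n) \<in> X" "snd (s n) \<in> F (fst (s n))" "0 \<le> snd (s n) \<bullet> (y - fst (s n))" for n
        using s by (auto simp: case_prod_beta)
      have "a \<in> X"
        using closed_sequentially[OF compact_imp_closed[OF assms(2)] _ lx] s' by blast
      moreover have "p \<in> F a"
        using F_lim[OF lx lp] s' by blast
      moreover have "0 \<le> p \<bullet> (y - a)"
        by (rule LIMSEQ_le_const[OF tendsto_inner[OF lp tendsto_diff[OF tendsto_const lx]]]) (use s' in auto)
      ultimately show "a \<in> X \<and> p \<in> F a \<and> 0 \<le> p \<bullet> (y - a)" by blast
    qed
    moreover have "?G \<subseteq> X \<times> cball 0 CARD('p)"
      using F_bound by auto
    then have "bounded ?G"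
      by (rule bounded_subset[OF bounded_Times[OF compact_imp_bounded[OF assms(2)] bounded_cball]])
    ultimately have "compact (fst ` ?G)"
      by (intro compact_continuous_image continuous_intros) (simp add: compact_eq_bounded_closed)
    then have "closed (fst ` ?G)"
      by (rule compact_imp_closed)
    moreover have "{x \<in> X. y \<in> T x} = X - fst ` ?G"
      using y by (force simp: T_def not_less)
    ultimately show ?thesis
      by (simp add: Diff_eq open_Compl openin_open_Int)
  qed
  obtain x where "x \<in> X" "x \<in> T x"
    using fan_browder_fixed_point[OF assms(2,1,3) T_ne _ T_conv T_open] by (auto simp: T_def)
  \<comment> \<open>At a fixed point the inequality defining \<open>T\<close> reads
    \<open>p \<bullet> 0 < 0\<close> for every \<open>p\<close> in the non-empty set
    \<open>F x\<close>.\<close>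
  then show False
    using F_ne[of x] by (auto simp: T_def)
qed

end
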